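(* Let $d\geq 3$. Then there exist constants $c_1,c_2\geq 0$ such that the following holds. For every positive integer $n$, there exists a family of $n$ axis-parallel boxes in $\mathbb{R}^d$ whose intersection graph has clique number at most $c_1\frac{\log n}{\log\log n}$ and independence number at most $c_2 n \left(\frac{\log n}{\log\log n}\right)^{-(d-1)}$.
   Context: Boxes are closed axis-parallel boxes $\prod_{i=1}^d [a_i,b_i]$. The intersection graph of a family of sets has the members of the family as vertices, two joined by an edge if they have nonempty intersection. The constants $c_1,c_2$ depend only on $d$.
   Formalization: The claim is stated for every integer n ≥ 3 rather than every positive integer n: for n = 1 the quantity log log n is undefined, and for n = 2 it is negative (natural log), so the clique bound would be non-positive and false. *)

theory Defs
  imports "HOL-Analysis.Analysis" "HOL-Library.Ramsey"
begin

text \<open>Boxes are nonempty (every interval satisfies \<open>a $ i \<le> b $ i\<close>) but may be degenerate.\<close>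

definition axis_box :: "(real ^ 'd) set \<Rightarrow> bool" where
  "axis_box B \<longleftrightarrow> (\<exists>a b. (\<forall>i. a $ i \<le> b $ i) \<and> B = cbox a b)"

text \<open>
  A graph is given by a vertex set \<open>V\<close> and a set \<open>E\<close> of two-element edges, the representation
  that \<^const>\<open>clique\<close> and \<^const>\<open>indep\<close> use. The vertex set of the intersection graph of \<open>F\<close> is
  \<open>F\<close> itself.
\<close>

definition intersection_edges :: "'a set set \<Rightarrow> 'a set set set" where
  "intersection_edges F = {{A, B} | A B. A \<in> F \<and> B \<in> F \<and> A \<noteq> B \<and> A \<inter> B \<noteq> {}}"

text \<open>Both numbers are meaningful only for finite \<open>V\<close>.\<close>

definition clique_number :: "'v set \<Rightarrow> 'v set set \<Rightarrow> nat" where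
  "clique_number V E = Max {card K | K. K \<subseteq> V \<and> clique K E}"

definition independence_number :: "'v set \<Rightarrow> 'v set set \<Rightarrow> nat" where
  "independence_number V E = Max {card I | I. I \<subseteq> V \<and> indep I E}"

end

theory Submission
  imports Defs "HOL-Real_Asymp.Real_Asymp"
begin

text \<open>
  Work with lattice points in \<open>[0, b\<^sup>K)\<^sup>d\<close> and the \<open>b\<close>-adic boxes with side lengths \<open>b ^ e t\<close>, where
  \<open>e\<close> ranges over \<open>T \<approx> r ^ (d - 1)\<close> exponent vectors of sum \<open>K = (d - 1) r\<close>. The boxes with a given
  exponent vector tile the grid, there are \<open>N\<close> of them, and two distinct boxes share at most a
  fraction \<open>1 / b\<close> of their points. Take \<open>r \<approx> log n / log log n\<close>, \<open>b\<close> a large power of \<open>log n\<close> with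
  \<open>N \<approx> n\<close>, and a random set of \<open>n\<close> of the \<open>T N\<close> boxes, i.e. density \<open>p = n / (T N)\<close>.

  A lattice point lies in one chosen box on average, so by a union bound over the points no point
  lies in more than \<open>O(log n / log log n)\<close> of them, and boxes have the Helly property.
  For independent sets, any family of more than \<open>2 N\<close> boxes contains one that meets at least \<open>b\<close>
  others, by a second moment computation. Hence the partition function \<open>\<Sum> l ^ |I|\<close> over all
  independent \<open>I\<close> is at most \<open>exp (2 l N + T N ln b / b)\<close>, and comparing at \<open>l = exp 1 * p\<close> shows that
  the expected number of independent \<open>m\<close>-sets among the chosen boxes is small once
  \<open>m \<ge> 8 n / T\<close>.

  Real boxes are obtained from lattice boxes as the hulls \<open>[l, u]\<close> of their lattice points, which
  keeps neighbouring cells of a tiling disjoint although the boxes are closed.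
\<close>

section \<open>Random subsets and independent sets\<close>

text \<open>Deleting a vertex \<open>v\<close> of large degree, the partition function satisfies
  \<open>Z(U) \<le> Z(U - v) + l Z(U - N[v])\<close>, and \<open>N[v]\<close> is so large that this costs a factor of at most \<open>exp \<delta>\<close>;
  sets of at most \<open>c\<close> vertices contribute at most \<open>(1 + l)\<^sup>c\<close>.\<close>

lemma sum_hard_core_le:
  fixes R :: "'a \<Rightarrow> 'a \<Rightarrow> bool" and l c D \<delta> :: real
  assumes "finite U" and "0 \<le> l" and "0 \<le> \<delta>" and l: "l * exp (- (\<delta> * D)) \<le> \<delta>"
    and "\<And>W. W \<subseteq> U \<Longrightarrow> c < real (card W) \<Longrightarrow>
      \<exists>v\<in>W. D \<le> real (card {w \<in> W. w \<noteq> v \<and> \<not> R v w})"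
  shows "(\<Sum>I | I \<subseteq> U \<and> pairwise R I. l ^ card I) \<le> exp (l * c + \<delta> * real (card U))"
  using assms(1,5)
proof (induction U rule: finite_psubset_induct)
  case (psubset U)
  show ?case
  proof (cases "c < real (card U)")
    case False
    have "(\<Sum>I | I \<subseteq> U \<and> pairwise R I. l ^ card I) \<le> (\<Sum>I \<in> Pow U. l ^ card I)"
      using psubset.hyps \<open>0 \<le> l\<close> by (intro sum_mono2) auto
    also have "\<dots> = (1 + l) ^ card U"
      using psubset.hyps
      by (subst add.commute) (simp flip: prod_constant add: prod_add)
    also have "\<dots> \<le> exp l ^ card U"
      using \<open>0 \<le> l\<close> by (intro power_mono) auto
    also have "\<dots> = exp (l * real (card U))"
      by (simp add: exp_of_nat2_mult)
    also have "\<dots> \<le> exp (l * c + \<delta> * real (card U))"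
    proof -
      have "l * real (card U) \<le> l * c" using False \<open>0 \<le> l\<close> by (intro mult_left_mono) auto
      then show ?thesis using \<open>0 \<le> \<delta>\<close> by (simp add: add_increasing2)
    qed
    finally show ?thesis .
  next
    case True
    then obtain v where v: "v \<in> U" and D: "D \<le> real (card {w \<in> U. w \<noteq> v \<and> \<not> R v w})"
      using psubset.prems[of U] by auto
    \<comment> \<open>\<open>R\<close> is non-adjacency, so \<open>N\<close> is the neighbourhood of
      \<open>v\<close> in \<open>U\<close>; an independent set containing \<open>v\<close> has all
      its other elements in \<open>U2\<close>.\<close>
    define N where "N = {w \<in> U. w \<noteq> v \<and> \<not> R v w}"
    define Z where "Z W = (\<Sum>I | I \<subseteq> W \<and> pairwise R I. l ^ card I)" for W
    define U1 where "U1 = U - {v}"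
    define U2 where "U2 = U - {v} - N"
    have fin: "finite U" "finite U1" "finite U2" "finite N"
      using psubset.hyps by (auto simp: U1_def U2_def N_def)
    have less: "U1 \<subset> U" "U2 \<subset> U" using v by (auto simp: U1_def U2_def)
    have IH: "Z W \<le> exp (l * c + \<delta> * real (card W))" if "W \<subset> U" for W
      unfolding Z_def using psubset.IH[OF that] psubset.prems that by blast
    have cU1: "real (card U1) = real (card U) - 1"
      using v fin card_gt_0_iff[of U] by (auto simp: U1_def of_nat_diff)
    have cU2: "real (card U2) = real (card U) - 1 - real (card N)"
    proof -
      have "N \<subseteq> U1" by (auto simp: N_def U1_def)
      then have "card (U1 - N) = card U1 - card N" "card N \<le> card U1"
        using fin by (auto simp: card_Diff_subset card_mono)
      then show ?thesis using cU1 by (simp add: U2_def U1_def of_nat_diff)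
    qed
    have "Z U \<le> (\<Sum>I \<in> {I. I \<subseteq> U1 \<and> pairwise R I} \<union> insert v ` {I. I \<subseteq> U2 \<and> pairwise R I}. l ^ card I)"
      unfolding Z_def
    proof (intro sum_mono2)
      show "{I. I \<subseteq> U \<and> pairwise R I} \<subseteq> {I. I \<subseteq> U1 \<and> pairwise R I} \<union> insert v ` {I. I \<subseteq> U2 \<and> pairwise R I}"
      proof
        fix I assume "I \<in> {I. I \<subseteq> U \<and> pairwise R I}"
        then have I: "I \<subseteq> U" "pairwise R I" by auto
        show "I \<in> {I. I \<subseteq> U1 \<and> pairwise R I} \<union> insert v ` {I. I \<subseteq> U2 \<and> pairwise R I}"
        proof (cases "v \<in> I")
          case True
          have "I - {v} \<subseteq> U2"
            using I True by (auto simp: U2_def N_def pairwise_def)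
          moreover have "pairwise R (I - {v})" using I by (auto simp: pairwise_def)
          ultimately show ?thesis using True by (intro UnI2 image_eqI[of _ _ "I - {v}"]) auto
        qed (use I in \<open>auto simp: U1_def\<close>)
      qed
    qed (use fin \<open>0 \<le> l\<close> in auto)
    also have "\<dots> \<le> Z U1 + (\<Sum>I \<in> insert v ` {I. I \<subseteq> U2 \<and> pairwise R I}. l ^ card I)"
      unfolding Z_def using fin \<open>0 \<le> l\<close> by (subst sum_Un) (auto intro!: sum_nonneg)
    also have "(\<Sum>I \<in> insert v ` {I. I \<subseteq> U2 \<and> pairwise R I}. l ^ card I) = l * Z U2"
    proof -
      have v2: "v \<notin> I" if "I \<subseteq> U2" for I using that by (auto simp: U2_def)
      have "inj_on (insert v) {I. I \<subseteq> U2 \<and> pairwise R I}"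
        using v2 by (auto simp: inj_on_def dest: insert_ident)
      moreover have "card (insert v I) = Suc (card I)" if "I \<subseteq> U2" for I
        using v2[OF that] fin that by (simp add: finite_subset)
      ultimately show ?thesis
        unfolding Z_def by (auto simp: sum.reindex sum_distrib_left intro!: sum.cong)
    qed
    also have "Z U1 + l * Z U2 \<le> exp (l * c + \<delta> * real (card U1)) + l * exp (l * c + \<delta> * real (card U2))"
      using IH less \<open>0 \<le> l\<close> by (intro add_mono mult_left_mono) auto
    also have "\<dots> = exp (l * c + \<delta> * real (card U1)) * (1 + l * exp (- (\<delta> * real (card N))))"
      unfolding cU1 cU2 by (simp add: algebra_simps flip: exp_add)
    \<comment> \<open>Losing \<open>N\<close> shrinks the second term by at least the factor
      \<open>exp (- (\<delta> * D))\<close>, so by the assumption relating \<open>l\<close>,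
      \<open>\<delta>\<close> and \<open>D\<close> the bracket is at most
      \<open>1 + \<delta> \<le> exp \<delta>\<close>. Counting \<open>v\<close> in
      \<open>card U\<close> pays for this.\<close>
    also have "\<dots> \<le> exp (l * c + \<delta> * real (card U1)) * exp \<delta>"
    proof (intro mult_left_mono)
      have "l * exp (- (\<delta> * real (card N))) \<le> l * exp (- (\<delta> * D))"
        using D \<open>0 \<le> l\<close> \<open>0 \<le> \<delta>\<close> by (intro mult_left_mono) (auto simp: N_def mult_left_mono)
      then show "1 + l * exp (- (\<delta> * real (card N))) \<le> exp \<delta>"
        using l exp_ge_add_one_self[of \<delta>] by linarith
    qed auto
    also have "\<dots> = exp (l * c + \<delta> * real (card U))"
      unfolding cU1 by (simp add: algebra_simps flip: exp_add)
    finally show ?thesis by (simp add: Z_def)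
  qed
qed

text \<open>Divided by \<open>M choose n\<close>, the left side is the probability that a random
  \<open>n\<close>-subset of an \<open>M\<close>-set contains a given \<open>t\<close>-set: a
  product of factors \<open>(n - i) / (M - i)\<close>, each at most \<open>n / M\<close>. Sampling
  without replacement is thus no worse than independent sampling.\<close>

lemma binomial_diff_le:
  fixes M n t :: nat
  assumes "t \<le> n" "n \<le> M"
  shows "real ((M - t) choose (n - t)) \<le> (real n / real M) ^ t * real (M choose n)"
  using assms(1)
proof (induction t)
  case (Suc t)
  then have t: "t < n" "t < M" using assms by auto
  have "real (n - t) * real ((M - t) choose (n - t)) = real (M - t) * real ((M - Suc t) choose (n - Suc t))"
    using Suc_times_binomial_eq[of "M - Suc t" "n - Suc t"] t
    by (metis Suc_diff_Suc mult.commute of_nat_mult)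
  then have "real ((M - Suc t) choose (n - Suc t)) = real (n - t) / real (M - t) * real ((M - t) choose (n - t))"
    using t by (simp add: field_simps)
  also have "\<dots> \<le> real n / real M * ((real n / real M) ^ t * real (M choose n))"
  proof (intro mult_mono)
    have "t * n \<le> t * M" using assms by simp
    then have "(n - t) * M \<le> n * (M - t)"
      by (simp add: diff_mult_distrib diff_mult_distrib2 mult.commute diff_le_mono2)
    then have "real (n - t) * real M \<le> real n * real (M - t)" by (metis of_nat_le_iff of_nat_mult)
    then show "real (n - t) / real (M - t) \<le> real n / real M" using t by (simp add: field_simps)
  qed (use Suc in auto)
  finally show ?case by (simp add: mult.assoc)
qed simp

text \<open>First moment method: the sum bounds the expected number of members of
  \<open>\<Q>\<close> inside a uniformly random \<open>n\<close>-subset. It is phrased as a count of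
  \<open>n\<close>-subsets.\<close>

lemma ex_subset_avoiding:
  assumes "finite V" and n: "n \<le> card V" and Q: "\<Q> \<subseteq> Pow V"
    and less: "(\<Sum>Q\<in>\<Q>. (real n / real (card V)) ^ card Q) < 1"
  shows "\<exists>F \<subseteq> V. card F = n \<and> (\<forall>Q\<in>\<Q>. \<not> Q \<subseteq> F)"
proof (rule ccontr)
  assume neg: "\<not> ?thesis"
  have finQ: "finite \<Q>" using Q \<open>finite V\<close> by (meson finite_Pow_iff finite_subset)
  define S where "S Q = {F. F \<subseteq> V \<and> card F = n \<and> Q \<subseteq> F}" for Q
  have finS: "finite (S Q)" for Q using \<open>finite V\<close> by (simp add: S_def)
  have S: "real (card (S Q)) \<le> (real n / real (card V)) ^ card Q * real (card V choose n)"
    if "Q \<in> \<Q>" for Q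
  proof (cases "card Q \<le> n")
    case True
    have QV: "Q \<subseteq> V" "finite Q" using that Q \<open>finite V\<close> finite_subset by blast+
    have "card (S Q) \<le> card {G. G \<subseteq> V - Q \<and> card G = n - card Q}"
    proof (rule card_inj_on_le[where f = "\<lambda>F. F - Q"])
      show "inj_on (\<lambda>F. F - Q) (S Q)" by (auto simp: inj_on_def S_def)
      show "(\<lambda>F. F - Q) ` S Q \<subseteq> {G. G \<subseteq> V - Q \<and> card G = n - card Q}"
        using QV by (auto simp: S_def card_Diff_subset)
    qed (use \<open>finite V\<close> in auto)
    also have "\<dots> = (card V - card Q) choose (n - card Q)"
      using QV \<open>finite V\<close> by (subst n_subsets) (auto simp: card_Diff_subset)
    finally show ?thesis
      using binomial_diff_le[OF True n] by linarith
  next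
    case False
    have "S Q = {}"
      using False \<open>finite V\<close> by (auto simp: S_def) (meson card_mono finite_subset)
    then show ?thesis by simp
  qed
  have "real (card V choose n) = real (card {F. F \<subseteq> V \<and> card F = n})"
    using \<open>finite V\<close> by (simp add: n_subsets)
  also have "\<dots> \<le> real (card (\<Union>Q\<in>\<Q>. S Q))"
    using neg finQ finS by (intro of_nat_mono card_mono) (auto simp: S_def)
  also have "\<dots> \<le> (\<Sum>Q\<in>\<Q>. real (card (S Q)))"
    using card_UN_le[OF finQ, of S] by (metis of_nat_le_iff of_nat_sum)
  also have "\<dots> \<le> (\<Sum>Q\<in>\<Q>. (real n / real (card V)) ^ card Q * real (card V choose n))"
    using S by (intro sum_mono) auto
  also have "\<dots> < 1 * real (card V choose n)"
    unfolding sum_distrib_right[symmetric] using less n by (intro mult_strict_right_mono) auto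
  finally show False by simp
qed

section \<open>Incidence counting and the random subfamily\<close>

lemma sum_card_containing:
  assumes "finite P" "finite U" "\<And>A. A \<in> U \<Longrightarrow> A \<subseteq> P"
  shows "(\<Sum>x\<in>P. card {A \<in> U. x \<in> A}) = (\<Sum>A\<in>U. card A)"
proof -
  have "(\<Sum>x\<in>P. card {A \<in> U. x \<in> A}) = (\<Sum>x\<in>P. \<Sum>A\<in>U. if x \<in> A then 1 else 0)"
    using assms by (simp add: sum.If_cases Int_def)
  also have "\<dots> = (\<Sum>A\<in>U. \<Sum>x\<in>P. if x \<in> A then 1 else 0)"
    by (rule sum.swap)
  also have "\<dots> = (\<Sum>A\<in>U. card A)"
    using assms by (intro sum.cong) (auto simp: sum.If_cases Int_def intro!: arg_cong[where f = card])
  finally show ?thesis .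
qed

text \<open>The second moment of the covering multiplicity \<open>m\<close> is at least \<open>|U|\<^sup>2 h / N\<close> by
  Cauchy--Schwarz, while a pair of distinct members contributes at most \<open>h / b\<close> to it.\<close>

lemma ex_many_intersecting:
  fixes b :: real
  assumes "finite P" "finite U" and sub: "\<And>A. A \<in> U \<Longrightarrow> A \<subseteq> P" and "h > 0" "b > 0"
    and h: "\<And>A. A \<in> U \<Longrightarrow> card A = h"
    and b: "\<And>A B. A \<in> U \<Longrightarrow> B \<in> U \<Longrightarrow> A \<noteq> B \<Longrightarrow> b * real (card (A \<inter> B)) \<le> real h"
    and P: "card P = N * h" and U: "real (card U) > 2 * real N"
  shows "\<exists>A\<in>U. b \<le> real (card {B \<in> U. B \<noteq> A \<and> \<not> disjnt A B})"
proof (rule ccontr)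
  define deg where "deg A = real (card {B \<in> U. B \<noteq> A \<and> \<not> disjnt A B})" for A
  define m where "m x = real (card {A \<in> U. x \<in> A})" for x
  assume "\<not> ?thesis"
  then have deg: "deg A < b" if "A \<in> U" for A using that by (auto simp: deg_def not_le)
  have "U \<noteq> {}" using U by auto
  then have "P \<noteq> {}" using sub h \<open>h > 0\<close> by fastforce
  then have N: "N > 0" using P \<open>finite P\<close> by (cases N) auto
  have s1: "(\<Sum>x\<in>P. m x) = real (card U) * real h"
    using sum_card_containing[OF assms(1,2) sub] h unfolding m_def
    by (simp flip: of_nat_sum)
  \<comment> \<open>The diagonal pair contributes \<open>h\<close>, and the fewer than
    \<open>b\<close> members meeting \<open>A\<close> contribute at most \<open>h / b\<close>
    each.\<close>
  have row: "(\<Sum>B\<in>U. real (card (A \<inter> B))) < 2 * real h" if A: "A \<in> U" for A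
  proof -
    have "(\<Sum>B\<in>U - {A}. real (card (A \<inter> B))) = (\<Sum>B | B \<in> U \<and> B \<noteq> A \<and> \<not> disjnt A B. real (card (A \<inter> B)))"
      using \<open>finite U\<close> by (intro sum.mono_neutral_right) (auto simp: disjnt_def)
    also have "\<dots> \<le> (\<Sum>B | B \<in> U \<and> B \<noteq> A \<and> \<not> disjnt A B. real h / b)"
      using b[OF A] \<open>b > 0\<close> by (intro sum_mono) (auto simp: field_simps)
    also have "\<dots> = deg A * (real h / b)" by (simp add: deg_def)
    also have "\<dots> < b * (real h / b)"
      using deg[OF A] \<open>b > 0\<close> \<open>h > 0\<close> by (intro mult_strict_right_mono) auto
    also have "\<dots> = real h" using \<open>b > 0\<close> by simp
    finally show ?thesis using A \<open>finite U\<close> h by (subst sum.remove) auto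
  qed
  have "(\<Sum>x\<in>P. (m x)\<^sup>2) = (\<Sum>x\<in>P. \<Sum>A\<in>U. \<Sum>B\<in>U. if x \<in> A \<inter> B then 1 else 0)"
  proof (intro sum.cong refl)
    fix x
    have "m x = (\<Sum>A\<in>U. if x \<in> A then 1 else 0)"
      using \<open>finite U\<close> by (simp add: m_def sum.If_cases Int_def)
    then show "(m x)\<^sup>2 = (\<Sum>A\<in>U. \<Sum>B\<in>U. if x \<in> A \<inter> B then 1 else 0)"
      by (auto simp: power2_eq_square sum_product intro!: sum.cong)
  qed
  also have "\<dots> = (\<Sum>A\<in>U. \<Sum>B\<in>U. \<Sum>x\<in>P. if x \<in> A \<inter> B then 1 else 0)"
    by (subst sum.swap, rule sum.cong[OF refl], rule sum.swap)
  also have "\<dots> = (\<Sum>A\<in>U. \<Sum>B\<in>U. real (card (A \<inter> B)))"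
  proof (intro sum.cong refl)
    fix A B assume "A \<in> U" "B \<in> U"
    then have "P \<inter> (A \<inter> B) = A \<inter> B" using sub by blast
    then show "(\<Sum>x\<in>P. if x \<in> A \<inter> B then 1 else 0) = real (card (A \<inter> B))"
      using \<open>finite P\<close> by (simp add: sum.If_cases Collect_conj_eq flip: Int_def)
  qed
  also have "\<dots> < (\<Sum>A\<in>U. 2 * real h)"
    using row \<open>U \<noteq> {}\<close> \<open>finite U\<close> by (intro sum_strict_mono) auto
  finally have up: "(\<Sum>x\<in>P. (m x)\<^sup>2) < 2 * real (card U) * real h" by simp
  have "(\<Sum>x\<in>P. m x)\<^sup>2 \<le> (\<Sum>x\<in>P. (m x)\<^sup>2) * real (card P)"
    using Cauchy_Schwarz_ineq_sum[of m "\<lambda>_. 1" P] by simp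
  also have "\<dots> < (2 * real (card U) * real h) * real (card P)"
    using up \<open>P \<noteq> {}\<close> \<open>finite P\<close> by (intro mult_strict_right_mono) (auto simp: card_gt_0_iff)
  finally have "(real (card U) * real h)\<^sup>2 < 2 * real (card U) * real h * (real N * real h)"
    by (simp add: s1 P)
  then have "(real (card U) * real h * real h) * real (card U) < (real (card U) * real h * real h) * (2 * real N)"
    by (simp add: power2_eq_square mult_ac)
  then show False using U by (simp add: mult_less_cancel_left)
qed

text \<open>One union bound excludes two kinds of bad subsets: \<open>s\<close> boxes through a
  common point (\<open>Q1\<close>) and \<open>m\<close> pairwise disjoint boxes (\<open>Q2\<close>).
  In the application \<open>T\<close> is the number of tilings and \<open>N\<close> the number of
  cells in each.\<close>

lemma sparse_subfamily_exists:
  fixes b :: real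
  assumes "finite P" "finite V" and sub: "\<And>A. A \<in> V \<Longrightarrow> A \<subseteq> P" and "h > 0"
    and h: "\<And>A. A \<in> V \<Longrightarrow> card A = h"
    and b: "\<And>A B. A \<in> V \<Longrightarrow> B \<in> V \<Longrightarrow> A \<noteq> B \<Longrightarrow> b * real (card (A \<inter> B)) \<le> real h"
    and P: "card P = N * h"
    and T: "\<And>x. x \<in> P \<Longrightarrow> card {A \<in> V. x \<in> A} = T"
    and "T \<ge> 3" "T \<le> n" "n \<le> N" "N \<le> 3 * n" "b \<ge> 3"
    and Tb: "3 * (real T)\<^sup>2 * ln b \<le> b" and s: "2 * card P < fact s"
  shows "\<exists>F \<subseteq> V. card F = n \<and> (\<forall>x\<in>P. card {A \<in> F. x \<in> A} < s) \<and>
    (\<forall>I \<subseteq> F. pairwise disjnt I \<longrightarrow> real (card I) < 8 * real n / real T + 1)"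
proof -
  have pos: "n > 0" "N > 0" "b > 0" and "T > 0" using assms by auto
  have "T * (N * h) = card V * h"
    using sum_card_containing[OF assms(1,2) sub] h T P by (simp add: mult.commute)
  then have "(T * N) * h = card V * h" by (simp only: mult.assoc)
  then have V: "card V = T * N" using \<open>h > 0\<close> by (metis mult_cancel2 less_numeral_extra(3))
  \<comment> \<open>As \<open>card V = T * N\<close>, a point lies in
    \<open>T * p = n / N \<le> 1\<close> chosen boxes on average.\<close>
  define p where "p = real n / real (card V)"
  \<comment> \<open>The exponent of the partition function bound will be at most
    \<open>(6 + 1) * n / T\<close>; the factor 8 leaves \<open>- n / T \<le> - 1\<close> in total.
    Rounding up causes the \<open>+ 1\<close> in the conclusion.\<close>
  define m where "m = nat \<lceil>8 * real n / real T\<rceil>"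
  have m: "8 * real n / real T \<le> real m" "real m < 8 * real n / real T + 1"
  proof -
    show "8 * real n / real T \<le> real m" unfolding m_def by (rule real_nat_ceiling_ge)
    have "8 * real n / real T \<ge> 0" by simp
    then show "real m < 8 * real n / real T + 1" unfolding m_def
      using ceiling_correct[of "8 * real n / real T"] by simp
  qed
  have p: "0 \<le> p" "real T * p \<le> 1" "p \<le> 1 / 3" "p * real N = real n / real T"
  proof -
    show "real T * p \<le> 1" "0 \<le> p" "p * real N = real n / real T"
      using assms pos by (auto simp: p_def V)
    then show "p \<le> 1 / 3" using \<open>T \<ge> 3\<close> mult_right_mono[of 3 "real T" p] by simp
  qed
  define Q1 where "Q1 = (\<Union>x\<in>P. {Q. Q \<subseteq> {A \<in> V. x \<in> A} \<and> card Q = s})"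
  define Q2 where "Q2 = {Q. Q \<subseteq> V \<and> pairwise disjnt Q \<and> card Q = m}"
  have fin: "finite Q1" "finite Q2"
    using assms(1,2) by (auto simp: Q1_def Q2_def)
  \<comment> \<open>A point lies in \<open>T\<close> boxes of \<open>V\<close>, and \<open>(T choose
    s) * p ^ s \<le> (T * p) ^ s / fact s \<le> 1 / fact s\<close>. Summed over \<open>P\<close>,
    this is below 1/2 by the hypothesis on \<open>fact s\<close>.\<close>
  have S1: "(\<Sum>Q\<in>Q1. p ^ card Q) < 1 / 2"
  proof -
    have "(\<Sum>Q\<in>Q1. p ^ card Q) = real (card Q1) * p ^ s"
      by (auto simp: Q1_def intro!: sum.cong)
    also have "card Q1 \<le> (\<Sum>x\<in>P. card {Q. Q \<subseteq> {A \<in> V. x \<in> A} \<and> card Q = s})"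
      unfolding Q1_def using \<open>finite P\<close> by (rule card_UN_le)
    also have "\<dots> = card P * (T choose s)"
      using \<open>finite V\<close> T by (simp add: n_subsets)
    finally have "(\<Sum>Q\<in>Q1. p ^ card Q) \<le> real (card P * (T choose s)) * p ^ s"
      using p by (metis mult_right_mono of_nat_le_iff zero_le_power)
    also have "\<dots> * fact s = real (card P) * (real ((T choose s) * fact s) * p ^ s)" by simp
    also have "\<dots> \<le> real (card P) * (real (T ^ s) * p ^ s)"
      using binomial_fact_pow[of T s] p by (intro mult_left_mono mult_right_mono of_nat_mono) auto
    also have "\<dots> = real (card P) * (real T * p) ^ s" by (simp add: power_mult_distrib)
    also have "\<dots> \<le> real (card P) * 1"
      using p by (intro mult_left_mono power_le_one) auto
    finally have "2 * ((\<Sum>Q\<in>Q1. p ^ card Q) * fact s) \<le> real (2 * card P)" by simp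
    also have "\<dots> < fact s" using s by (metis of_nat_fact of_nat_less_iff)
    finally show ?thesis by simp
  qed
  have S2: "(\<Sum>Q\<in>Q2. p ^ card Q) \<le> 1 / 2"
  proof -
    \<comment> \<open>Exponential tilting: \<open>p ^ m = exp (- m) * l ^ m\<close>, so the sum over
      \<open>Q2\<close> is \<open>exp (- m)\<close> times a part of the partition function at
      \<open>l\<close>. With \<open>D = b\<close>, the choice of \<open>\<delta>\<close> makes
      \<open>exp (- (\<delta> * b)) = 1 / b\<close>, and the condition on \<open>l\<close> reduces
      to \<open>l \<le> 1 \<le> ln b\<close>.\<close>
    define l where "l = exp 1 * p"
    define \<delta> where "\<delta> = ln b / b"
    have "0 \<le> l" "0 \<le> \<delta>" using p \<open>b \<ge> 3\<close> by (auto simp: l_def \<delta>_def)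
    have "l * exp (- (\<delta> * b)) \<le> \<delta>"
    proof -
      have "l \<le> 3 * (1 / 3)" unfolding l_def using exp_le p by (intro mult_mono) auto
      have "exp (- (\<delta> * b)) = 1 / b"
        using pos by (simp add: \<delta>_def exp_minus inverse_eq_divide)
      moreover have "1 \<le> ln b" using \<open>b \<ge> 3\<close> exp_le ln_ge_iff[of b 1] by linarith
      ultimately show ?thesis using \<open>l \<le> 3 * (1/3)\<close> pos by (simp add: \<delta>_def divide_right_mono)
    qed
    moreover have "\<exists>v\<in>W. b \<le> real (card {w \<in> W. w \<noteq> v \<and> \<not> disjnt v w})"
      if W: "W \<subseteq> V" "2 * real N < real (card W)" for W
      using W finite_subset[OF W(1) \<open>finite V\<close>] assms(1,3-6) P \<open>b > 0\<close>
      by (intro ex_many_intersecting[where P = P and h = h and N = N]) blast+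
    ultimately have Z: "(\<Sum>I | I \<subseteq> V \<and> pairwise disjnt I. l ^ card I)
        \<le> exp (l * (2 * real N) + \<delta> * real (card V))"
      using \<open>finite V\<close> \<open>0 \<le> l\<close> \<open>0 \<le> \<delta>\<close> by (intro sum_hard_core_le) auto
    have "(\<Sum>Q\<in>Q2. p ^ card Q) = exp (- real m) * (\<Sum>Q\<in>Q2. l ^ card Q)"
      unfolding sum_distrib_left
      by (intro sum.cong) (auto simp: Q2_def l_def power_mult_distrib exp_minus simp flip: exp_of_nat_mult)
    also have "\<dots> \<le> exp (- real m) * (\<Sum>I | I \<subseteq> V \<and> pairwise disjnt I. l ^ card I)"
      using \<open>finite V\<close> \<open>0 \<le> l\<close> by (intro mult_left_mono sum_mono2) (auto simp: Q2_def)
    also have "\<dots> \<le> exp (- real m) * exp (l * (2 * real N) + \<delta> * real (card V))"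
      using Z by simp
    also have "\<dots> = exp (- real m + l * (2 * real N) + \<delta> * real (card V))"
      by (simp only: exp_add mult.assoc)
    also have "\<dots> \<le> exp (- 1)"
    proof -
      have "l * (2 * real N) = 2 * exp 1 * (p * real N)" by (simp add: l_def)
      also have "\<dots> \<le> 2 * 3 * (real n / real T)"
        using exp_le p by (intro mult_mono) auto
      finally have 1: "l * (2 * real N) \<le> 6 * (real n / real T)" by simp
      have "\<delta> * real (card V) * real T = real N * ((real T)\<^sup>2 * ln b / b)"
        by (simp add: \<delta>_def V power2_eq_square)
      also have "\<dots> \<le> (3 * real n) * (1 / 3)"
        using Tb \<open>N \<le> 3 * n\<close> pos \<open>b \<ge> 3\<close> by (intro mult_mono) (auto simp: field_simps)
      finally have 2: "\<delta> * real (card V) \<le> real n / real T"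
        using \<open>T > 0\<close> by (simp add: field_simps)
      have "1 \<le> real n / real T" using \<open>T \<le> n\<close> \<open>T > 0\<close> by simp
      then show ?thesis using 1 2 m(1) by simp
    qed
    also have "\<dots> \<le> 1 / 2"
      using exp_ge_add_one_self[of 1] by (simp add: exp_minus field_simps)
    finally show ?thesis .
  qed
  have "(\<Sum>Q\<in>Q1 \<union> Q2. p ^ card Q) \<le> (\<Sum>Q\<in>Q1. p ^ card Q) + (\<Sum>Q\<in>Q2. p ^ card Q)"
    using fin p by (subst sum_Un) (auto intro!: sum_nonneg)
  then have "(\<Sum>Q\<in>Q1 \<union> Q2. p ^ card Q) < 1" using S1 S2 by linarith
  moreover have "n \<le> card V" using V \<open>n \<le> N\<close> \<open>T > 0\<close> by (cases T) auto
  moreover have "Q1 \<union> Q2 \<subseteq> Pow V" by (auto simp: Q1_def Q2_def)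
  ultimately have "\<exists>F \<subseteq> V. card F = n \<and> (\<forall>Q \<in> Q1 \<union> Q2. \<not> Q \<subseteq> F)"
    unfolding p_def using \<open>finite V\<close> by (intro ex_subset_avoiding)
  then obtain F where F: "F \<subseteq> V" "card F = n" and av: "\<And>Q. Q \<in> Q1 \<union> Q2 \<Longrightarrow> \<not> Q \<subseteq> F"
    by blast
  show ?thesis
  proof (intro exI[of _ F] conjI ballI allI impI F)
    fix x assume "x \<in> P"
    show "card {A \<in> F. x \<in> A} < s"
    proof (rule ccontr)
      assume "\<not> ?thesis"
      then obtain Q where "Q \<subseteq> {A \<in> F. x \<in> A}" "card Q = s"
        using obtain_subset_with_card_n[of s "{A \<in> F. x \<in> A}"] by auto
      then have "Q \<in> Q1" "Q \<subseteq> F" using F \<open>x \<in> P\<close> by (auto simp: Q1_def)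
      then show False using av by blast
    qed
  next
    fix I assume I: "I \<subseteq> F" "pairwise disjnt I"
    have "card I < m"
    proof (rule ccontr)
      assume "\<not> ?thesis"
      then obtain Q where Q: "Q \<subseteq> I" "card Q = m"
        using obtain_subset_with_card_n[of m I] by auto
      then have "Q \<in> Q2" "Q \<subseteq> F" using F I pairwise_subset[of disjnt I Q] by (auto simp: Q2_def)
      then show False using av by blast
    qed
    then show "real (card I) < 8 * real n / real T + 1" using m by linarith
  qed
qed

section \<open>Lattice boxes\<close>

text \<open>The empty set is included (some \<open>l t > u t\<close>), hence the separate clauses
  \<open>A \<noteq> {}\<close> below.\<close>

definition lattice_box :: "('d \<Rightarrow> nat) set \<Rightarrow> bool" where
  "lattice_box A \<longleftrightarrow> (\<exists>l u. A = {y. \<forall>t. l t \<le> y t \<and> y t \<le> u t})"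

text \<open>The cell containing \<open>x\<close> in the tiling with side lengths
  \<open>b ^ e t\<close>, encoded as an equivalence class so that cells of one tiling are equal or
  disjoint.\<close>

definition lattice_cell :: "nat \<Rightarrow> ('d \<Rightarrow> nat) \<Rightarrow> ('d \<Rightarrow> nat) \<Rightarrow> ('d \<Rightarrow> nat) set" where
  "lattice_cell b e x = {y. \<forall>t. y t div b ^ e t = x t div b ^ e t}"

lemma nat_div_eq_iff:
  fixes q :: nat
  assumes "q > 0"
  shows "y div q = c \<longleftrightarrow> c * q \<le> y \<and> y < c * q + q"
proof -
  have "y div q = c \<longleftrightarrow> c \<le> y div q \<and> y div q < c + 1" by auto
  then show ?thesis
    using assms by (simp add: less_eq_div_iff_mult_less_eq div_less_iff_less_mult add.commute)
qed

lemma lattice_box_cell: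
  assumes "b > 0"
  shows "lattice_box (lattice_cell b e x)"
  unfolding lattice_box_def
proof (intro exI)
  \<comment> \<open>The \<open>- 1\<close> turns the half-open range of a quotient into a closed
    one; nothing is truncated because \<open>b ^ e t > 0\<close>.\<close>
  show "lattice_cell b e x = {y. \<forall>t. x t div b ^ e t * b ^ e t \<le> y t
      \<and> y t \<le> x t div b ^ e t * b ^ e t + b ^ e t - 1}"
    unfolding lattice_cell_def
  proof (intro Collect_cong all_cong1)
    fix y t
    have "b ^ e t > 0" using assms by simp
    then show "y t div b ^ e t = x t div b ^ e t \<longleftrightarrow> x t div b ^ e t * b ^ e t \<le> y t
        \<and> y t \<le> x t div b ^ e t * b ^ e t + b ^ e t - 1"
      by (subst nat_div_eq_iff) linarith+
  qed
qed

lemma card_lattice_cell: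
  fixes x :: "'d::finite \<Rightarrow> nat"
  assumes "b > 0"
  shows "card (lattice_cell b e x) = b ^ (\<Sum>t\<in>UNIV. e t)"
proof -
  have "lattice_cell b e x = PiE UNIV (\<lambda>t. {x t div b ^ e t * b ^ e t..<x t div b ^ e t * b ^ e t + b ^ e t})"
    using assms by (auto simp: lattice_cell_def nat_div_eq_iff PiE_def Pi_def)
  then show ?thesis by (simp add: card_PiE power_sum)
qed

lemma lattice_cell_eq_iff: "lattice_cell b e x = lattice_cell b e y \<longleftrightarrow> y \<in> lattice_cell b e x"
proof
  assume "y \<in> lattice_cell b e x"
  then have "\<And>t. y t div b ^ e t = x t div b ^ e t" by (simp add: lattice_cell_def)
  then show "lattice_cell b e x = lattice_cell b e y" unfolding lattice_cell_def by presburger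
qed (simp add: lattice_cell_def)

text \<open>In each coordinate, \<open>y\<close> and the common point \<open>z\<close> lie in the
  same interval of whichever tiling has the smaller exponent.\<close>

lemma lattice_cell_Int_subset:
  assumes "z \<in> lattice_cell b e x \<inter> lattice_cell b e' x'"
  shows "lattice_cell b e x \<inter> lattice_cell b e' x' \<subseteq> lattice_cell b (\<lambda>t. min (e t) (e' t)) z"
proof
  fix y assume "y \<in> lattice_cell b e x \<inter> lattice_cell b e' x'"
  then have "y t div b ^ min (e t) (e' t) = z t div b ^ min (e t) (e' t)" for t
    using assms by (cases "e t \<le> e' t") (simp_all add: lattice_cell_def min_absorb1 min_absorb2)
  then show "y \<in> lattice_cell b (\<lambda>t. min (e t) (e' t)) z" by (simp add: lattice_cell_def)
qed

text \<open>Distinct cells sharing a point have different exponent vectors. Since both sums are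
  \<open>K\<close>, the coordinatewise minimum has sum below \<open>K\<close>, which saves at least
  one factor \<open>b\<close>.\<close>

lemma card_lattice_cell_Int:
  fixes x x' :: "'d::finite \<Rightarrow> nat"
  assumes "b > 0" and e: "sum e UNIV = K" "sum e' UNIV = K" 
    and ne: "lattice_cell b e x \<noteq> lattice_cell b e' x'"
  shows "b * card (lattice_cell b e x \<inter> lattice_cell b e' x') \<le> b ^ K"
proof (cases "lattice_cell b e x \<inter> lattice_cell b e' x' = {}")
  case False
  then obtain z where z: "z \<in> lattice_cell b e x \<inter> lattice_cell b e' x'" by blast
  have "e \<noteq> e'" using z ne by (auto simp: lattice_cell_eq_iff[symmetric])
  have "\<exists>t. e' t < e t"
  proof (rule ccontr)
    assume "\<not> ?thesis"
    then have le: "\<And>t. e t \<le> e' t" by (simp add: not_less)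
    moreover obtain t where "e t \<noteq> e' t" using \<open>e \<noteq> e'\<close> by blast
    ultimately have "sum e UNIV < sum e' UNIV"
      by (intro sum_strict_mono_ex1) (auto intro!: exI[of _ t] simp: order.strict_iff_order)
    then show False using e by simp
  qed
  then have "(\<Sum>t\<in>UNIV. min (e t) (e' t)) < sum e UNIV"
    by (intro sum_strict_mono_ex1) (auto simp: min_less_iff_disj)
  then have less: "Suc (\<Sum>t\<in>UNIV. min (e t) (e' t)) \<le> K" using e by simp
  have "finite (lattice_cell b (\<lambda>t. min (e t) (e' t)) z)"
    using card_lattice_cell[OF \<open>b > 0\<close>, of "\<lambda>t. min (e t) (e' t)" z] \<open>b > 0\<close>
    by (intro card_ge_0_finite) simp
  then have "card (lattice_cell b e x \<inter> lattice_cell b e' x') \<le> b ^ (\<Sum>t\<in>UNIV. min (e t) (e' t))"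
    using card_mono[OF _ lattice_cell_Int_subset[OF z]] card_lattice_cell[OF \<open>b > 0\<close>] by metis
  then have "b * card (lattice_cell b e x \<inter> lattice_cell b e' x') \<le> b ^ Suc (\<Sum>t\<in>UNIV. min (e t) (e' t))"
    by simp
  also have "\<dots> \<le> b ^ K" using less \<open>b > 0\<close> by (intro power_increasing) auto
  finally show ?thesis .
qed simp

text \<open>All but one of the exponents range freely over \<open>{..r}\<close>; the last one is determined by the sum.\<close>

lemma exponents_exist:
  assumes "CARD('d::finite) = Suc g"
  shows "\<exists>E :: ('d \<Rightarrow> nat) set. finite E \<and> card E = Suc r ^ g \<and> (\<forall>e\<in>E. sum e UNIV = g * r)"
proof -
  obtain t0 :: 'd where True by simp
  define X where "X = PiE (UNIV - {t0}) (\<lambda>_. {..r})"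
  \<comment> \<open>The subtraction is never truncated, since the other \<open>g\<close> coordinates
    are at most \<open>r\<close> each; the update also overwrites the undefined value at
    \<open>t0\<close>.\<close>
  define \<phi> where "\<phi> f = f(t0 := g * r - sum f (UNIV - {t0}))" for f :: "'d \<Rightarrow> nat"
  have g: "card (UNIV - {t0}) = g" using assms by (simp add: card_Diff_subset)
  have "inj_on \<phi> X"
  proof (rule inj_onI)
    fix f f' assume f: "f \<in> X" "f' \<in> X" "\<phi> f = \<phi> f'"
    show "f = f'"
    proof
      fix t show "f t = f' t"
        using f(1,2) fun_cong[OF f(3), of t]
        by (cases "t = t0") (simp_all add: \<phi>_def X_def PiE_def extensional_def)
    qed
  qed
  then have "card (\<phi> ` X) = Suc r ^ g"
    using g by (simp add: card_image X_def card_PiE)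
  moreover have "sum (\<phi> f) UNIV = g * r" if "f \<in> X" for f
  proof -
    have "sum f (UNIV - {t0}) \<le> (\<Sum>t\<in>UNIV - {t0}. r)"
      using that by (intro sum_mono) (auto simp: X_def)
    then have "sum f (UNIV - {t0}) \<le> g * r" using g by simp
    moreover have "sum (\<phi> f) (UNIV - {t0}) = sum f (UNIV - {t0})"
      by (intro sum.cong) (auto simp: \<phi>_def)
    ultimately show ?thesis
      by (subst sum.remove[of _ t0]) (auto simp: \<phi>_def)
  qed
  moreover have "finite X" by (auto simp: X_def intro!: finite_PiE)
  ultimately show ?thesis by (intro exI[of _ "\<phi> ` X"]) auto
qed

text \<open>The grid has \<open>b ^ (K * Suc g)\<close> points with \<open>K = g * r\<close>, and a
  cell has \<open>b ^ K\<close>, so each tiling has \<open>b ^ (K * g) = N\<close> cells. As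
  \<open>b ^ K \<le> N\<close>, the grid has at most \<open>N^2\<close> points, whence the
  hypothesis on \<open>fact s\<close>.\<close>

lemma lattice_family_exists:
  assumes d: "CARD('d::finite) = Suc g" and "g > 0" "b \<ge> 3" and N: "N = b ^ (g * g * r)"
    and "Suc r ^ g \<ge> 3" "Suc r ^ g \<le> n" "n \<le> N" "N \<le> 3 * n"
    and Tb: "3 * (real (Suc r ^ g))\<^sup>2 * ln (real b) \<le> real b" and s: "2 * N\<^sup>2 < fact s"
  shows "\<exists>F :: ('d \<Rightarrow> nat) set set. card F = n \<and>
    (\<forall>A\<in>F. lattice_box A \<and> A \<noteq> {}) \<and>
    (\<forall>x. card {A \<in> F. x \<in> A} \<le> s) \<and>
    (\<forall>I \<subseteq> F. pairwise disjnt I \<longrightarrow> real (card I) \<le> 8 * real n / real (Suc r ^ g) + 1)"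
proof -
  have "b > 0" using \<open>b \<ge> 3\<close> by simp
  define K where "K = g * r"
  define P where "P = {x :: 'd \<Rightarrow> nat. \<forall>t. x t < b ^ K}"
  obtain E :: "('d \<Rightarrow> nat) set" where E: "finite E" "card E = Suc r ^ g"
    and K: "\<And>e. e \<in> E \<Longrightarrow> sum e UNIV = K"
    using exponents_exist[OF d, of r] unfolding K_def by blast
  define V where "V = (\<lambda>(e, x). lattice_cell b e x) ` (E \<times> P)"
  have P_PiE: "P = PiE UNIV (\<lambda>_. {..<b ^ K})" by (auto simp: P_def PiE_def Pi_def)
  have "finite P" unfolding P_PiE by (intro finite_PiE) auto
  have "card P = (b ^ K) ^ Suc g" by (simp add: P_PiE card_PiE d)
  also have "(b ^ K) ^ g = N" by (simp add: N K_def ac_simps flip: power_mult)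
  then have "(b ^ K) ^ Suc g = N * b ^ K" by simp
  finally have cP: "card P = N * b ^ K" .
  have "finite V" using \<open>finite P\<close> E by (simp add: V_def)
  \<comment> \<open>Cells do not stick out of the grid: \<open>e t \<le> K\<close>, so
    \<open>b ^ e t\<close> divides \<open>b ^ K\<close>.\<close>
  have sub: "A \<subseteq> P" if "A \<in> V" for A
  proof
    fix y assume "y \<in> A"
    from that obtain e x where ex: "e \<in> E" "x \<in> P" "A = lattice_cell b e x" by (auto simp: V_def)
    show "y \<in> P" unfolding P_def
    proof (intro CollectI allI)
      fix t
      have "e t \<le> sum e UNIV" by (intro member_le_sum) auto
      then have eq: "b ^ K = b ^ (K - e t) * b ^ e t" using K ex by (simp flip: power_add)
      have "x t < b ^ K" using ex by (simp add: P_def)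
      then have "x t div b ^ e t < b ^ (K - e t)"
        using \<open>b > 0\<close> unfolding eq by (simp add: div_less_iff_less_mult)
      moreover have "y t div b ^ e t = x t div b ^ e t"
        using \<open>y \<in> A\<close> ex by (simp add: lattice_cell_def)
      ultimately show "y t < b ^ K"
        using \<open>b > 0\<close> unfolding eq by (metis div_less_iff_less_mult zero_less_power)
    qed
  qed
  have h: "card A = b ^ K" if "A \<in> V" for A
    using that card_lattice_cell[OF \<open>b > 0\<close>] K by (auto simp: V_def)
  have ov: "real b * real (card (A \<inter> B)) \<le> real (b ^ K)" if AB: "A \<in> V" "B \<in> V" "A \<noteq> B" for A B
  proof -
    obtain e x e' x' where ex: "e \<in> E" "A = lattice_cell b e x" "e' \<in> E" "B = lattice_cell b e' x'"
      using AB by (auto simp: V_def)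
    have "b * card (A \<inter> B) \<le> b ^ K"
      unfolding ex using AB ex K by (intro card_lattice_cell_Int[OF \<open>b > 0\<close>]) auto
    then show ?thesis by (metis of_nat_le_iff of_nat_mult)
  qed
  have T: "card {A \<in> V. x \<in> A} = Suc r ^ g" if "x \<in> P" for x
  proof -
    have "{A \<in> V. x \<in> A} = (\<lambda>e. lattice_cell b e x) ` E"
    proof (intro equalityI subsetI)
      fix A assume "A \<in> {A \<in> V. x \<in> A}"
      then obtain e y where "e \<in> E" "A = lattice_cell b e y" "x \<in> lattice_cell b e y"
        by (auto simp: V_def)
      then show "A \<in> (\<lambda>e. lattice_cell b e x) ` E"
        using lattice_cell_eq_iff[of b e y x] by blast
    next
      fix A assume "A \<in> (\<lambda>e. lattice_cell b e x) ` E"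
      then obtain e where "e \<in> E" "A = lattice_cell b e x" by blast
      moreover have "x \<in> lattice_cell b e x" by (simp add: lattice_cell_def)
      ultimately show "A \<in> {A \<in> V. x \<in> A}" using that by (auto simp: V_def)
    qed
    \<comment> \<open>If two cells at \<open>x\<close> coincide, their size \<open>b ^ K\<close> is
      at most that of the cell with exponents \<open>m\<close>. So \<open>m\<close> also has sum at
      least \<open>K\<close>, and lying below \<open>e\<close> and \<open>e'\<close> it equals
      both.\<close>
    moreover have "inj_on (\<lambda>e. lattice_cell b e x) E"
    proof (rule inj_onI, rule ccontr)
      fix e e' assume e: "e \<in> E" "e' \<in> E" "lattice_cell b e x = lattice_cell b e' x" "e \<noteq> e'"
      define m where "m = (\<lambda>t. min (e t) (e' t))"
      have mem: "x \<in> lattice_cell b e x \<inter> lattice_cell b e' x" by (simp add: lattice_cell_def)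
      have "finite (lattice_cell b m x)"
        using card_lattice_cell[OF \<open>b > 0\<close>, of m x] \<open>b > 0\<close> by (intro card_ge_0_finite) simp
      then have "b ^ K \<le> b ^ sum m UNIV"
        using card_mono[OF _ lattice_cell_Int_subset[OF mem]] e K
        by (simp add: card_lattice_cell[OF \<open>b > 0\<close>] flip: m_def)
      then have le: "K \<le> sum m UNIV" using \<open>b \<ge> 3\<close> by (simp add: power_increasing_iff)
      have "m t = f t" if "f \<in> {e, e'}" for t f
      proof -
        have "sum m UNIV \<le> sum f UNIV" using that by (intro sum_mono) (auto simp: m_def)
        then have "sum m UNIV = sum f UNIV" using le K e that by auto
        then show ?thesis
          using that by (intro sum_mono_inv[of m UNIV f]) (auto simp: m_def)
      qed
      then show False using \<open>e \<noteq> e'\<close> by (metis ext insertCI)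
    qed
    ultimately show ?thesis using E by (simp add: card_image)
  qed
  have "2 * card P < fact s"
  proof -
    have "b ^ K \<le> N"
      unfolding N K_def using \<open>b > 0\<close> \<open>g > 0\<close> by (intro power_increasing) auto
    then have "2 * card P \<le> 2 * N\<^sup>2" by (simp add: cP power2_eq_square)
    then show ?thesis using s by linarith
  qed
  then have "\<exists>F \<subseteq> V. card F = n \<and> (\<forall>x\<in>P. card {A \<in> F. x \<in> A} < s) \<and>
      (\<forall>I \<subseteq> F. pairwise disjnt I \<longrightarrow> real (card I) < 8 * real n / real (Suc r ^ g) + 1)"
    using \<open>b \<ge> 3\<close>
    by (intro sparse_subfamily_exists[OF \<open>finite P\<close> \<open>finite V\<close> sub _ h ov cP T assms(5-8) _ Tb]) auto
  then obtain F where F: "F \<subseteq> V" "card F = n" "\<And>x. x \<in> P \<Longrightarrow> card {A \<in> F. x \<in> A} < s"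
    "\<And>I. I \<subseteq> F \<Longrightarrow> pairwise disjnt I \<Longrightarrow> real (card I) < 8 * real n / real (Suc r ^ g) + 1"
    by blast
  show ?thesis
  proof (intro exI[of _ F] conjI ballI allI impI)
    fix A assume "A \<in> F"
    with F(1) obtain e x where A: "A = lattice_cell b e x" by (auto simp: V_def)
    then have "x \<in> A" by (simp add: A lattice_cell_def)
    then show "A \<noteq> {}" by blast
    show "lattice_box A" unfolding A by (rule lattice_box_cell[OF \<open>b > 0\<close>])
  next
    fix x
    show "card {A \<in> F. x \<in> A} \<le> s"
    proof (cases "x \<in> P")
      case False
      then have "{A \<in> F. x \<in> A} = {}" using F sub by blast
      then show ?thesis by (simp only: card.empty)
    qed (use F(3) in \<open>simp add: less_imp_le\<close>)
  qed (use F in \<open>auto simp: less_imp_le\<close>)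
qed

section \<open>From lattice boxes to boxes in Euclidean space\<close>

lemma lattice_box_bounds:
  assumes "\<And>A. A \<in> F \<Longrightarrow> lattice_box A"
  obtains l u where "\<And>A y. A \<in> F \<Longrightarrow> y \<in> A \<longleftrightarrow> (\<forall>t. l A t \<le> y t \<and> y t \<le> u A t)"
proof -
  have "\<exists>p. \<forall>y. y \<in> A \<longleftrightarrow> (\<forall>t. fst p t \<le> y t \<and> y t \<le> snd p t)" if "A \<in> F" for A
    using assms[OF that] unfolding lattice_box_def by auto
  then obtain p where p: "\<forall>A\<in>F. \<forall>y. y \<in> A \<longleftrightarrow> (\<forall>t. fst (p A) t \<le> y t \<and> y t \<le> snd (p A) t)"
    using bchoice[of F "\<lambda>A p. \<forall>y. y \<in> A \<longleftrightarrow> (\<forall>t. fst p t \<le> y t \<and> y t \<le> snd p t)"] by blast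
  show ?thesis using p by (intro that[of "fst \<circ> p" "snd \<circ> p"]) auto
qed

text \<open>The coordinatewise maximum of the lower corners works: pairwise intersection puts every
  lower bound below every upper bound. The case \<open>A = B\<close> of \<open>meet\<close> provides
  non-emptiness.\<close>

lemma Helly_lattice_boxes:
  fixes K :: "('d \<Rightarrow> nat) set set"
  assumes "finite K" and box: "\<And>A. A \<in> K \<Longrightarrow> lattice_box A"
    and meet: "\<And>A B. A \<in> K \<Longrightarrow> B \<in> K \<Longrightarrow> A \<inter> B \<noteq> {}"
  shows "\<exists>x. \<forall>A\<in>K. x \<in> A"
proof (cases "K = {}")
  case False
  obtain l u where lu: "\<And>A y. A \<in> K \<Longrightarrow> y \<in> A \<longleftrightarrow> (\<forall>t. l A t \<le> y t \<and> y t \<le> u A t)"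
    using lattice_box_bounds[OF box] by blast
  define x where "x t = Max ((\<lambda>A. l A t) ` K)" for t
  have "l A t \<le> x t" if "A \<in> K" for A t
    unfolding x_def using that \<open>finite K\<close> by (intro Max_ge) auto
  moreover have "x t \<le> u A t" if A: "A \<in> K" for A t
  proof -
    have "l B t \<le> u A t" if B: "B \<in> K" for B
    proof -
      obtain y where "y \<in> A" "y \<in> B" using meet[OF A B] by blast
      then show ?thesis using lu[OF A] lu[OF B] by (meson order.trans)
    qed
    then show ?thesis unfolding x_def using False \<open>finite K\<close> by (subst Max_le_iff) auto
  qed
  ultimately have "x \<in> A" if "A \<in> K" for A using that by (simp add: lu)
  then show ?thesis by blast
qed simp

text \<open>Replacing a lattice box by its real hull creates no new intersections: if two hulls
  meet, the coordinatewise maximum of their lower corners is a lattice point of both.\<close>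

lemma axis_box_realization:
  fixes F :: "('d::finite \<Rightarrow> nat) set set"
  assumes box: "\<And>A. A \<in> F \<Longrightarrow> lattice_box A \<and> A \<noteq> {}"
  shows "\<exists>f :: ('d \<Rightarrow> nat) set \<Rightarrow> (real ^ 'd) set. inj_on f F \<and> (\<forall>A\<in>F. axis_box (f A)) \<and>
    (\<forall>A\<in>F. \<forall>B\<in>F. f A \<inter> f B \<noteq> {} \<longleftrightarrow> A \<inter> B \<noteq> {})"
proof -
  have "\<And>A. A \<in> F \<Longrightarrow> lattice_box A" using box by blast
  from lattice_box_bounds[OF this] obtain l u
    where lu: "\<And>A y. A \<in> F \<Longrightarrow> y \<in> A \<longleftrightarrow> (\<forall>t. l A t \<le> y t \<and> y t \<le> u A t)"
    by blast
  define f :: "('d \<Rightarrow> nat) set \<Rightarrow> (real ^ 'd) set"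
    where "f A = cbox (\<chi> t. real (l A t)) (\<chi> t. real (u A t))" for A
  have mem: "(\<chi> t. real (y t)) \<in> f A \<longleftrightarrow> y \<in> A" if "A \<in> F" for A y
    using that by (simp add: f_def mem_box_cart lu)
  show ?thesis
  proof (intro exI[of _ f] conjI ballI)
    show "inj_on f F"
    proof (rule inj_onI)
      fix A B assume "A \<in> F" "B \<in> F" "f A = f B"
      then have "y \<in> A \<longleftrightarrow> y \<in> B" for y using mem[of A y] mem[of B y] by simp
      then show "A = B" by blast
    qed
  next
    fix A assume "A \<in> F"
    then obtain y where "y \<in> A" using box by blast
    then have "\<forall>t. l A t \<le> u A t" using lu[OF \<open>A \<in> F\<close>] by (meson order.trans)
    then show "axis_box (f A)"
      unfolding axis_box_def f_def by (intro exI conjI refl) auto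
  next
    fix A B assume A: "A \<in> F" and B: "B \<in> F"
    show "f A \<inter> f B \<noteq> {} \<longleftrightarrow> A \<inter> B \<noteq> {}"
    proof
      assume "f A \<inter> f B \<noteq> {}"
      then obtain z where z: "z \<in> f A" "z \<in> f B" by blast
      define y where "y t = max (l A t) (l B t)" for t
      have z': "real (l C t) \<le> z $ t" "z $ t \<le> real (u C t)" if "C \<in> {A, B}" for C t
        using z that by (auto simp: f_def mem_box_cart)
      have le: "l C t \<le> u D t" if "C \<in> {A, B}" "D \<in> {A, B}" for C D t
        using z'(1)[OF that(1), of t] z'(2)[OF that(2), of t] by linarith
      have "(\<chi> t. real (y t)) \<in> f A" "(\<chi> t. real (y t)) \<in> f B"
        using le by (simp_all add: f_def mem_box_cart y_def)
      then show "A \<inter> B \<noteq> {}" using mem[OF A, of y] mem[OF B, of y] by blast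
    next
      assume "A \<inter> B \<noteq> {}"
      then obtain y where "y \<in> A" "y \<in> B" by blast
      then show "f A \<inter> f B \<noteq> {}" using mem[OF A, of y] mem[OF B, of y] by blast
    qed
  qed
qed

section \<open>Clique and independence numbers of intersection graphs\<close>

lemma intersection_edges_iff:
  assumes "A \<in> F" "B \<in> F" "A \<noteq> B"
  shows "{A, B} \<in> intersection_edges F \<longleftrightarrow> A \<inter> B \<noteq> {}"
proof
  assume "{A, B} \<in> intersection_edges F"
  then obtain C D where "{A, B} = {C, D}" "C \<inter> D \<noteq> {}" unfolding intersection_edges_def by blast
  then show "A \<inter> B \<noteq> {}" unfolding doubleton_eq_iff by (metis Int_commute)
next
  assume "A \<inter> B \<noteq> {}"
  then show "{A, B} \<in> intersection_edges F" using assms unfolding intersection_edges_def by blast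
qed

lemma clique_number_le:
  assumes "finite V" "\<And>K. K \<subseteq> V \<Longrightarrow> clique K E \<Longrightarrow> card K \<le> s"
  shows "clique_number V E \<le> s"
proof -
  have "clique {} E" by (simp add: clique_def)
  then have "{card K | K. K \<subseteq> V \<and> clique K E} \<noteq> {}" by blast
  moreover have "finite {card K | K. K \<subseteq> V \<and> clique K E}"
    using \<open>finite V\<close> by (intro finite_image_set) auto
  ultimately show ?thesis unfolding clique_number_def using assms by (subst Max_le_iff) auto
qed

lemma independence_number_le:
  assumes "finite V" "\<And>K. K \<subseteq> V \<Longrightarrow> indep K E \<Longrightarrow> real (card K) \<le> s"
  shows "real (independence_number V E) \<le> s"
proof -
  have "indep {} E" by (simp add: indep_def)
  then have "{card K | K. K \<subseteq> V \<and> indep K E} \<noteq> {}" by blast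
  moreover have "finite {card K | K. K \<subseteq> V \<and> indep K E}"
    using \<open>finite V\<close> by (intro finite_image_set) auto
  ultimately have "independence_number V E \<in> {card K | K. K \<subseteq> V \<and> indep K E}"
    unfolding independence_number_def by (rule Max_in[rotated])
  then show ?thesis using assms by auto
qed

text \<open>By the Helly property a clique consists of boxes through one lattice point, so covering
  depth bounds the clique number; independent sets are pairwise disjoint subfamilies. Injectivity of
  the realization preserves cardinalities.\<close>

lemma axis_box_family_exists:
  fixes F :: "('d::finite \<Rightarrow> nat) set set"
  assumes "finite F"
    and box: "\<And>A. A \<in> F \<Longrightarrow> lattice_box A \<and> A \<noteq> {}"
    and s: "\<And>x. card {A \<in> F. x \<in> A} \<le> s"
    and m: "\<And>I. I \<subseteq> F \<Longrightarrow> pairwise disjnt I \<Longrightarrow> real (card I) \<le> m"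
  shows "\<exists>G :: (real ^ 'd) set set. finite G \<and> card G = card F \<and> (\<forall>B\<in>G. axis_box B) \<and>
    clique_number G (intersection_edges G) \<le> s \<and>
    real (independence_number G (intersection_edges G)) \<le> m"
proof -
  obtain f :: "('d \<Rightarrow> nat) set \<Rightarrow> (real ^ 'd) set"
    where f: "inj_on f F" "\<And>A. A \<in> F \<Longrightarrow> axis_box (f A)"
      and Int: "\<And>A B. A \<in> F \<Longrightarrow> B \<in> F \<Longrightarrow> f A \<inter> f B \<noteq> {} \<longleftrightarrow> A \<inter> B \<noteq> {}"
    using axis_box_realization[of F] box by metis
  have edge: "{f A, f B} \<in> intersection_edges (f ` F) \<longleftrightarrow> A \<inter> B \<noteq> {}"
    if "A \<in> F" "B \<in> F" "A \<noteq> B" for A B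
  proof -
    have "f A \<noteq> f B" using that f(1) by (meson inj_onD)
    then show ?thesis using intersection_edges_iff[of "f A" "f ` F" "f B"] Int[of A B] that by simp
  qed
  show ?thesis
  proof (intro exI[of _ "f ` F"] conjI)
    show "clique_number (f ` F) (intersection_edges (f ` F)) \<le> s"
    proof (rule clique_number_le)
      fix K assume K: "K \<subseteq> f ` F" "clique K (intersection_edges (f ` F))"
      then obtain J where J: "J \<subseteq> F" "K = f ` J" by (meson subset_imageE)
      have "finite J" using J \<open>finite F\<close> finite_subset by blast
      \<comment> \<open>A clique only speaks about distinct members; for \<open>A = B\<close>
        non-emptiness supplies what the Helly property asks for.\<close>
      moreover have "A \<inter> B \<noteq> {}" if "A \<in> J" "B \<in> J" for A B
      proof (cases "A = B")
        case True
        then show ?thesis using box[of A] that J(1) by blast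
      next
        case False
        then have "f A \<noteq> f B" using that J(1) f(1) by (meson inj_onD subsetD)
        then have "{f A, f B} \<in> intersection_edges (f ` F)"
          using K(2) that unfolding clique_def J(2) by blast
        then show ?thesis using edge[of A B] that J(1) False by blast
      qed
      moreover have "lattice_box A" if "A \<in> J" for A
        using box[of A] J(1) that by blast
      ultimately obtain x where x: "\<And>A. A \<in> J \<Longrightarrow> x \<in> A"
        using Helly_lattice_boxes[of J] by metis
      have "card K \<le> card J" unfolding J(2) using \<open>finite J\<close> by (rule card_image_le)
      also have "\<dots> \<le> card {A \<in> F. x \<in> A}" using x J(1) \<open>finite F\<close> by (intro card_mono) auto
      also have "\<dots> \<le> s" by (rule s)
      finally show "card K \<le> s" .
    qed (use \<open>finite F\<close> in simp)
    show "real (independence_number (f ` F) (intersection_edges (f ` F))) \<le> m"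
    proof (rule independence_number_le)
      fix K assume K: "K \<subseteq> f ` F" "indep K (intersection_edges (f ` F))"
      then obtain J where J: "J \<subseteq> F" "K = f ` J" by (meson subset_imageE)
      have "pairwise disjnt J"
      proof (rule pairwiseI)
        fix A B assume AB: "A \<in> J" "B \<in> J" "A \<noteq> B"
        then have "f A \<noteq> f B" using AB J(1) f(1) by (meson inj_onD subsetD)
        then have "{f A, f B} \<notin> intersection_edges (f ` F)"
          using K(2) AB unfolding indep_def J(2) by blast
        then show "disjnt A B" using edge[of A B] AB J(1) unfolding disjnt_def by blast
      qed
      then have "real (card J) \<le> m" using m[of J] J(1) by blast
      moreover have "card K = card J" using J f(1) by (metis card_image inj_on_subset)
      ultimately show "real (card K) \<le> m" by simp
    qed (use \<open>finite F\<close> in simp)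
  qed (use f(1,2) \<open>finite F\<close> in \<open>simp_all add: card_image\<close>)
qed

section \<open>Choice of parameters\<close>

text \<open>The term \<open>k = s\<close> of the exponential series at \<open>s\<close>.\<close>

lemma power_self_le_exp_fact: "real s ^ s \<le> exp (real s) * fact s"
proof -
  have "(\<Sum>k\<in>{s}. real s ^ k /\<^sub>R fact k) \<le> (\<Sum>k. real s ^ k /\<^sub>R fact k)"
    by (intro sum_le_suminf summable_exp_generic) auto
  then show ?thesis by (simp add: exp_def field_simps)
qed

text \<open>From \<open>fact s \<ge> (s / e)^s\<close>: as \<open>s \<ge> 6 * sqrt L\<close>,
  \<open>ln s - 1 \<ge> ln L / 2\<close>, and
  \<open>s * (ln s - 1) \<ge> 6 * \<rho> * ln L / 2 = 3 * L\<close>.\<close>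

lemma power_le_fact:
  fixes L \<rho> :: real
  assumes "sqrt L \<le> \<rho>" "L \<ge> 1" "\<rho> * ln L = L" "6 * \<rho> \<le> real s"
  shows "exp L ^ 3 \<le> fact s"
proof -
  have \<rho>: "1 \<le> \<rho>" using assms(1,2) real_sqrt_ge_one[of L] by linarith
  have "1 \<le> ln (6::real)" using exp_le ln_ge_iff[of 6 1] by linarith
  moreover have "ln (sqrt L) = ln L / 2" using assms by (simp add: ln_sqrt)
  moreover have "ln (6 * sqrt L) = ln 6 + ln (sqrt L)" using assms by (intro ln_mult_pos) auto
  moreover have "ln (6 * sqrt L) \<le> ln (real s)" using assms \<rho> by (intro ln_mono) auto
  ultimately have lns: "ln L / 2 \<le> ln (real s) - 1" by linarith
  have "3 * L = 6 * \<rho> * (ln L / 2)" using assms(3) by simp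
  also have "\<dots> \<le> real s * (ln (real s) - 1)"
    using lns assms \<rho> by (intro mult_mono) auto
  finally have "exp (3 * L) \<le> exp (real s * ln (real s)) / exp (real s)"
    by (simp add: algebra_simps flip: exp_diff)
  also have "exp (real s * ln (real s)) = real s ^ s"
    using assms \<rho> by (subst exp_of_nat_mult) simp
  also have "\<dots> / exp (real s) \<le> fact s"
    using power_self_le_exp_fact[of s] by (simp add: field_simps)
  finally show ?thesis by (simp flip: exp_of_nat_mult)
qed

text \<open>Here \<open>g = d - 1\<close>. The constant \<open>c\<close> ensures
  \<open>4 * Suc g * D \<le> \<rho>\<close> for the exponent \<open>D\<close> of
  \<open>N = b ^ D\<close>, so \<open>b\<close>, about \<open>n\<close> to the power
  \<open>1 / D\<close>, is at least \<open>L ^ (4 * Suc g)\<close>. The independence bound comes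
  from \<open>T \<ge> (\<rho> / c) ^ g\<close>.\<close>

lemma axis_boxes_large:
  fixes n g :: nat and L \<rho> c :: real
  defines "L \<equiv> ln (real n)" and "\<rho> \<equiv> ln (real n) / ln (ln (real n))"
    and "c \<equiv> real (4 * Suc g * (g * g))"
  assumes d: "CARD('d::finite) = Suc g" and "g > 0"
    and \<rho>: "2 * c \<le> \<rho>" "sqrt L \<le> \<rho>" and L: "18 \<le> L" "1 \<le> ln L" "L ^ g \<le> exp L"
  shows "\<exists>F :: (real ^ 'd) set set. finite F \<and> card F = n \<and> (\<forall>B\<in>F. axis_box B) \<and>
    real (clique_number F (intersection_edges F)) \<le> 7 * \<rho> \<and>
    real (independence_number F (intersection_edges F)) \<le> 9 * c ^ g * real n / \<rho> ^ g"
proof -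
  have "n > 0" using L by (intro gr0I) (simp add: L_def)
  then have expL: "exp L = real n" by (simp add: L_def)
  have \<rho>L: "\<rho> * ln L = L" "\<rho> \<le> L" "\<rho> \<ge> 1"
  proof -
    show "\<rho> * ln L = L" using L by (simp add: \<rho>_def L_def)
    show "\<rho> \<ge> 1" using \<rho>(2) L real_sqrt_ge_one[of L] by linarith
    then have "\<rho> * 1 \<le> \<rho> * ln L" using L by (intro mult_left_mono) auto
    then show "\<rho> \<le> L" using \<open>\<rho> * ln L = L\<close> by simp
  qed
  have "1 * 1 \<le> g * g" using \<open>g > 0\<close> by (intro mult_le_mono) auto
  then have "4 * 1 * 1 \<le> 4 * Suc g * (g * g)" by (intro mult_le_mono) auto
  then have c: "c \<ge> 4" unfolding c_def by (metis mult.right_neutral of_nat_le_iff of_nat_numeral)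
  define r where "r = nat \<lfloor>\<rho> / c\<rfloor>"
  have r: "real r \<le> \<rho> / c" "\<rho> / c < real (Suc r)" "r \<ge> 2"
  proof -
    have 2: "2 \<le> \<rho> / c" using \<rho> c by (simp add: field_simps)
    show "real r \<le> \<rho> / c" "\<rho> / c < real (Suc r)" unfolding r_def using 2 by linarith+
    show "r \<ge> 2" unfolding r_def using le_nat_floor[of 2 "\<rho> / c"] 2 by simp
  qed
  define D where "D = g * g * r"
  have "D > 0" using \<open>g > 0\<close> r by (simp add: D_def)
  have "real r * c \<le> \<rho>" using r(1) c by (simp add: field_simps)
  then have D\<rho>: "real (4 * Suc g) * real D \<le> \<rho>" by (simp add: D_def c_def algebra_simps)
  define x where "x = exp (L / real D)"
  have xD: "x ^ D = real n"
    using \<open>D > 0\<close> expL by (simp add: x_def flip: exp_of_nat_mult)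
  have x: "L ^ (4 * Suc g) \<le> x"
  proof -
    have "real (4 * Suc g) * real D * ln L \<le> \<rho> * ln L"
      using D\<rho> L by (intro mult_right_mono) auto
    then have "real (4 * Suc g) * ln L \<le> L / real D"
      using \<rho>L \<open>D > 0\<close> by (simp add: field_simps)
    then have "exp (real (4 * Suc g) * ln L) \<le> x" unfolding x_def by simp
    then show ?thesis using L by (simp only: exp_of_nat_mult) simp
  qed
  have Lx: "L \<le> x"
  proof -
    have "L ^ 1 \<le> L ^ (4 * Suc g)" using L by (intro power_increasing) auto
    then show ?thesis using x by simp
  qed
  have Dx: "real D \<le> x"
  proof -
    have "1 * real D \<le> real (4 * Suc g) * real D" by (intro mult_right_mono) auto
    then show ?thesis using D\<rho> \<rho>L Lx by linarith
  qed
  define b where "b = nat \<lceil>x\<rceil>"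
  have b: "x \<le> real b" "real b \<le> x + 1"
    using Lx L unfolding b_def by linarith+
  have "b \<ge> 3" using b Lx L by linarith
  define N where "N = b ^ (g * g * r)"
  have N: "real N = real b ^ D" by (simp add: N_def D_def)
  have nN: "n \<le> N"
  proof -
    have "x ^ D \<le> real b ^ D" using b Lx L by (intro power_mono) auto
    then have "real n \<le> real N" by (simp only: xD N)
    then show ?thesis by simp
  qed
  \<comment> \<open>Rounding \<open>x\<close> up to \<open>b\<close> costs a factor
    \<open>(1 + 1 / x) ^ D \<le> exp (D / x) \<le> exp 1\<close>, because
    \<open>D \<le> x\<close>.\<close>
  have N3: "N \<le> 3 * n"
  proof -
    have "x * (1 + 1 / x) = x + 1" using Lx L by (simp add: field_simps)
    then have "real N \<le> (x * (1 + 1 / x)) ^ D"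
      unfolding N using b by (intro power_mono) auto
    also have "\<dots> = real n * (1 + 1 / x) ^ D" by (simp only: power_mult_distrib xD)
    also have "\<dots> \<le> real n * exp (1 / x) ^ D"
      using Lx L by (intro mult_left_mono power_mono exp_ge_add_one_self) auto
    also have "\<dots> = real n * exp (real D / x)" by (simp flip: exp_of_nat_mult)
    also have "\<dots> \<le> real n * exp 1"
      using Dx Lx L by (intro mult_left_mono) auto
    also have "\<dots> \<le> real n * 3" using exp_le by (intro mult_left_mono) auto
    finally show ?thesis by linarith
  qed
  define T where "T = Suc r ^ g"
  have TL: "real T \<le> L ^ g"
  proof -
    have "\<rho> / c \<le> L / 2" using \<rho>L c by (intro frac_le) auto
    then have "real (Suc r) \<le> L" using r(1) L(1) unfolding of_nat_Suc by linarith
    then show ?thesis unfolding T_def of_nat_power by (intro power_mono) auto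
  qed
  have "T \<ge> 3"
  proof -
    have "Suc r ^ 1 \<le> Suc r ^ g" using \<open>g > 0\<close> by (intro power_increasing) auto
    then show ?thesis using r by (simp add: T_def)
  qed
  have "T \<le> n" using TL L(3) expL by linarith
  \<comment> \<open>With \<open>T \<le> L ^ g\<close>, the bound
    \<open>b \<ge> L ^ (4 * Suc g)\<close> yields \<open>6 * T^2 \<le> sqrt b\<close>; combine with
    \<open>ln b \<le> 2 * sqrt b\<close>.\<close>
  have Tb: "3 * (real T)\<^sup>2 * ln (real b) \<le> real b"
  proof -
    have "6 * (real T)\<^sup>2 \<le> L ^ 2 * (L ^ g) ^ 2"
      using TL L mult_mono[of 18 L 18 L]
      by (intro mult_mono power_mono) (auto simp: power2_eq_square)
    also have "\<dots> = sqrt (L ^ (4 * Suc g))"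
    proof -
      have "L ^ (4 * Suc g) = (L ^ 2 * (L ^ g) ^ 2) ^ 2"
        unfolding power_mult[symmetric] power_add[symmetric]
        by (intro arg_cong[where f = "\<lambda>k. L ^ k"]) simp
      then show ?thesis by (simp add: real_sqrt_abs)
    qed
    also have "\<dots> \<le> sqrt (real b)" using x b by simp
    finally have 6: "6 * (real T)\<^sup>2 \<le> sqrt (real b)" .
    have "ln (real b) = 2 * ln (sqrt (real b))" using \<open>b \<ge> 3\<close> by (simp add: ln_sqrt)
    also have "\<dots> \<le> 2 * sqrt (real b)"
      using \<open>b \<ge> 3\<close> ln_le_minus_one[of "sqrt (real b)"] by simp
    finally have "3 * (real T)\<^sup>2 * ln (real b) \<le> 3 * (real T)\<^sup>2 * (2 * sqrt (real b))"
      by (intro mult_left_mono) auto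
    also have "\<dots> = 6 * (real T)\<^sup>2 * sqrt (real b)" by simp
    also have "\<dots> \<le> sqrt (real b) * sqrt (real b)" using 6 by (intro mult_right_mono) auto
    finally show ?thesis by simp
  qed
  \<comment> \<open>Rounding stays within \<open>7 * \<rho>\<close> since
    \<open>\<rho> \<ge> 1\<close>, and \<open>6 * \<rho>\<close> is large enough for
    \<open>2 * N^2 \<le> 18 * n^2 < n^3 \<le> fact s\<close>.\<close>
  define s where "s = nat \<lceil>6 * \<rho>\<rceil>"
  have s: "6 * \<rho> \<le> real s" "real s \<le> 7 * \<rho>" using \<rho>L unfolding s_def by linarith+
  have "2 * N\<^sup>2 < fact s"
  proof -
    have "N\<^sup>2 \<le> (3 * n)\<^sup>2" using N3 by (intro power_mono) auto
    then have "2 * N\<^sup>2 \<le> 18 * n ^ 2" by (simp add: power2_eq_square)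
    also have "\<dots> < n * n ^ 2"
    proof -
      have "18 < real n" using exp_ge_add_one_self[of L] expL L by linarith
      then show ?thesis using \<open>n > 0\<close> by (intro mult_strict_right_mono) auto
    qed
    also have "\<dots> \<le> fact s"
    proof -
      have "real n ^ 3 \<le> fact s"
        using power_le_fact[OF \<rho>(2) _ \<rho>L(1) s(1)] L expL by simp
      then have "real (n ^ 3) \<le> real (fact s)" by simp
      then show ?thesis by (simp only: of_nat_le_iff) (simp add: power3_eq_cube power2_eq_square)
    qed
    finally show ?thesis .
  qed
  then have "\<exists>F :: ('d \<Rightarrow> nat) set set. card F = n \<and> (\<forall>A\<in>F. lattice_box A \<and> A \<noteq> {}) \<and>
    (\<forall>x. card {A \<in> F. x \<in> A} \<le> s) \<and>
    (\<forall>I \<subseteq> F. pairwise disjnt I \<longrightarrow> real (card I) \<le> 8 * real n / real T + 1)"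
    unfolding T_def
    by (intro lattice_family_exists[OF d \<open>g > 0\<close> \<open>b \<ge> 3\<close> N_def] nN N3
        \<open>T \<ge> 3\<close>[unfolded T_def] \<open>T \<le> n\<close>[unfolded T_def] Tb[unfolded T_def])
  then obtain F :: "('d \<Rightarrow> nat) set set" where F: "card F = n"
    "\<And>A. A \<in> F \<Longrightarrow> lattice_box A \<and> A \<noteq> {}" "\<And>x. card {A \<in> F. x \<in> A} \<le> s"
    "\<And>I. I \<subseteq> F \<Longrightarrow> pairwise disjnt I \<Longrightarrow> real (card I) \<le> 8 * real n / real T + 1"
    by blast
  have "finite F" using F(1) \<open>n > 0\<close> by (intro card_ge_0_finite) simp
  from axis_box_family_exists[OF this F(2-4)] obtain G :: "(real ^ 'd) set set"
    where G: "finite G" "card G = n" "\<forall>B\<in>G. axis_box B"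
      "clique_number G (intersection_edges G) \<le> s"
      "real (independence_number G (intersection_edges G)) \<le> 8 * real n / real T + 1"
    unfolding F(1) by blast
  have "8 * real n / real T + 1 \<le> 9 * real n / real T"
    using \<open>T \<le> n\<close> \<open>T \<ge> 3\<close> by (simp add: field_simps)
  also have "\<dots> \<le> 9 * real n / (\<rho> / c) ^ g"
  proof -
    have "(\<rho> / c) ^ g \<le> real T"
      unfolding T_def of_nat_power using r(2) \<rho>L c by (intro power_mono) auto
    moreover have "0 < (\<rho> / c) ^ g" using \<rho>L c by simp
    ultimately show ?thesis by (intro divide_left_mono) auto
  qed
  also have "\<dots> = 9 * c ^ g * real n / \<rho> ^ g" by (simp add: power_divide)
  finally have "8 * real n / real T + 1 \<le> 9 * c ^ g * real n / \<rho> ^ g" .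
  moreover have "real (clique_number G (intersection_edges G)) \<le> 7 * \<rho>"
    using G(4) s(2) by linarith
  ultimately show ?thesis using G by (intro exI[of _ G]) auto
qed

text \<open>Any \<open>n\<close> boxes satisfy these bounds; distinct points on the diagonal provide
  them. This covers \<open>n\<close> below the asymptotic threshold.\<close>

lemma axis_boxes_trivial:
  "\<exists>F :: (real ^ 'd) set set. finite F \<and> card F = n \<and> (\<forall>B\<in>F. axis_box B) \<and>
    real (clique_number F (intersection_edges F)) \<le> real n \<and>
    real (independence_number F (intersection_edges F)) \<le> real n"
proof -
  define f :: "nat \<Rightarrow> (real ^ 'd) set" where "f k = cbox (\<chi> t. real k) (\<chi> t. real k)" for k
  have "inj f" by (auto simp: inj_def f_def vec_eq_iff)
  then have card: "card (f ` {..<n}) = n" by (simp add: card_image inj_on_subset)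
  have le: "card K \<le> n" if "K \<subseteq> f ` {..<n}" for K
    using card_mono[OF _ that] card by simp
  have "axis_box (f k)" for k
    unfolding axis_box_def f_def by (intro exI conjI refl) auto
  moreover have "clique_number (f ` {..<n}) (intersection_edges (f ` {..<n})) \<le> n"
    using le by (intro clique_number_le) auto
  moreover have "real (independence_number (f ` {..<n}) (intersection_edges (f ` {..<n}))) \<le> real n"
    using le by (intro independence_number_le) auto
  ultimately show ?thesis
    using card by (intro exI[of _ "f ` {..<n}"]) auto
qed

section \<open>From large \<open>n\<close> to all \<open>n \<ge> 3\<close>\<close>

lemma eventually_axis_boxes_large:
  assumes d: "CARD('d::finite) = Suc g" and "g > 0"
  shows "\<exists>C1 C2 n0. C1 \<ge> 0 \<and> C2 \<ge> 0 \<and> (\<forall>n\<ge>n0.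
    \<exists>F :: (real ^ 'd) set set. finite F \<and> card F = n \<and> (\<forall>B\<in>F. axis_box B) \<and>
    real (clique_number F (intersection_edges F)) \<le> C1 * (ln (real n) / ln (ln (real n))) \<and>
    real (independence_number F (intersection_edges F))
      \<le> C2 * real n / (ln (real n) / ln (ln (real n))) ^ g)"
proof -
  define c where "c = real (4 * Suc g * (g * g))"
  have "eventually (\<lambda>L::real. 2 * c \<le> L / ln L) at_top"
  proof -
    have "filterlim (\<lambda>L::real. L / ln L) at_top at_top" by real_asymp
    then show ?thesis unfolding filterlim_at_top by blast
  qed
  moreover have "eventually (\<lambda>L::real. sqrt L \<le> L / ln L) at_top" by real_asymp
  moreover have "eventually (\<lambda>L::real. 18 \<le> L) at_top" by real_asymp
  moreover have "eventually (\<lambda>L::real. 1 \<le> ln L) at_top" by real_asymp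
  moreover have "eventually (\<lambda>L::real. L ^ g \<le> exp L) at_top"
  proof -
    have "eventually (\<lambda>L::real. L ^ g / exp L < 1) at_top"
      using tendsto_power_div_exp_0[of g] by (rule order_tendstoD) simp
    then show ?thesis by (rule eventually_mono) (simp add: field_simps)
  qed
  ultimately have "eventually (\<lambda>L::real. 2 * c \<le> L / ln L \<and> sqrt L \<le> L / ln L \<and> 18 \<le> L \<and>
      1 \<le> ln L \<and> L ^ g \<le> exp L) at_top"
    by eventually_elim auto
  moreover have "filterlim (\<lambda>n::nat. ln (real n)) at_top at_top" by real_asymp
  ultimately have "eventually (\<lambda>n::nat. 2 * c \<le> ln (real n) / ln (ln (real n)) \<and>
      sqrt (ln (real n)) \<le> ln (real n) / ln (ln (real n)) \<and> 18 \<le> ln (real n) \<and>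
      1 \<le> ln (ln (real n)) \<and> ln (real n) ^ g \<le> exp (ln (real n))) at_top"
    by (rule eventually_compose_filterlim)
  then obtain n0 where "\<forall>n\<ge>n0. 2 * c \<le> ln (real n) / ln (ln (real n)) \<and>
      sqrt (ln (real n)) \<le> ln (real n) / ln (ln (real n)) \<and> 18 \<le> ln (real n) \<and>
      1 \<le> ln (ln (real n)) \<and> ln (real n) ^ g \<le> exp (ln (real n))"
    unfolding eventually_at_top_linorder by blast
  then show ?thesis
    by (intro exI[of _ 7] exI[of _ "9 * c ^ g"] exI[of _ n0] conjI allI impI
        axis_boxes_large[OF d \<open>g > 0\<close>, folded c_def]) (auto simp: c_def)
qed

theorem theorem4:
  assumes "CARD('d::finite) \<ge> 3"
  shows "\<exists>c1 c2 :: real. c1 \<ge> 0 \<and> c2 \<ge> 0 \<and>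
    (\<forall>n::nat. n \<ge> 3 \<longrightarrow>
      (\<exists>F :: (real ^ 'd) set set.
        finite F \<and> card F = n \<and> (\<forall>B\<in>F. axis_box B) \<and>
        real (clique_number F (intersection_edges F)) \<le> c1 * (ln (real n) / ln (ln (real n))) \<and>
        real (independence_number F (intersection_edges F))
          \<le> c2 * real n * (ln (real n) / ln (ln (real n))) powi (- (int CARD('d) - 1))))"
proof -
  define g where "g = CARD('d) - 1"
  have g: "CARD('d) = Suc g" "g > 0" using assms by (auto simp: g_def)
  define \<rho> where "\<rho> n = ln (real n) / ln (ln (real n))" for n :: nat
  have powi: "\<rho> n powi (- (int CARD('d) - 1)) = 1 / \<rho> n ^ g" for n
    by (simp add: g power_int_minus inverse_eq_divide)
  \<comment> \<open>Since \<open>3 > exp 1\<close>, both logarithms are positive. For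
    \<open>n = 1\<close> and \<open>n = 2\<close> the quotient is not positive, so no bound of this
    shape could hold.\<close>
  have pos: "\<rho> n > 0" if "n \<ge> 3" for n
  proof -
    have "1 < ln (real n)"
    proof -
      have "exp 1 < (3 :: real)" using e_less_272 by simp
      then have "exp 1 < real n" using that by linarith
      then show ?thesis by (metis exp_gt_zero ln_exp ln_less_cancel_iff order_less_trans)
    qed
    then show ?thesis by (simp add: \<rho>_def)
  qed
  obtain C1 C2 n0 where C: "C1 \<ge> 0" "C2 \<ge> 0" and large: "\<And>n. n \<ge> n0 \<Longrightarrow>
    \<exists>F :: (real ^ 'd) set set. finite F \<and> card F = n \<and> (\<forall>B\<in>F. axis_box B) \<and>
    real (clique_number F (intersection_edges F)) \<le> C1 * \<rho> n \<and>
    real (independence_number F (intersection_edges F)) \<le> C2 * real n / \<rho> n ^ g"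
    using eventually_axis_boxes_large[OF g] unfolding \<rho>_def by blast
  \<comment> \<open>The sums absorb the finitely many \<open>n < n0\<close>: each contains the
    factor, \<open>n / \<rho> n\<close> or \<open>\<rho> n ^ g\<close>, that lifts the bound to at
    least the trivial value \<open>n\<close>.\<close>
  define c1 where "c1 = C1 + (\<Sum>n\<in>{3..<n0}. real n / \<rho> n)"
  define c2 where "c2 = C2 + (\<Sum>n\<in>{3..<n0}. \<rho> n ^ g)"
  have c1: "C1 \<le> c1" and c2: "C2 \<le> c2"
    using pos by (auto simp: c1_def c2_def less_imp_le intro!: sum_nonneg divide_nonneg_pos)
  have "\<exists>F :: (real ^ 'd) set set. finite F \<and> card F = n \<and> (\<forall>B\<in>F. axis_box B) \<and>
    real (clique_number F (intersection_edges F)) \<le> c1 * \<rho> n \<and>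
    real (independence_number F (intersection_edges F)) \<le> c2 * real n / \<rho> n ^ g"
    if n: "n \<ge> 3" for n
  proof (cases "n \<ge> n0")
    case True
    have "C1 * \<rho> n \<le> c1 * \<rho> n" "C2 * real n / \<rho> n ^ g \<le> c2 * real n / \<rho> n ^ g"
      using c1 c2 pos[OF n] by (auto intro!: mult_right_mono divide_right_mono)
    moreover obtain F :: "(real ^ 'd) set set"
      where "finite F" "card F = n" "\<forall>B\<in>F. axis_box B"
        "real (clique_number F (intersection_edges F)) \<le> C1 * \<rho> n"
        "real (independence_number F (intersection_edges F)) \<le> C2 * real n / \<rho> n ^ g"
      using large[OF True] by blast
    ultimately show ?thesis by (intro exI[of _ F] conjI) (assumption | linarith)+
  next
    case False
    then have mem: "n \<in> {3..<n0}" using n by simp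
    have "real n / \<rho> n \<le> (\<Sum>n\<in>{3..<n0}. real n / \<rho> n)"
      using mem pos by (intro member_le_sum) (auto intro!: divide_nonneg_pos)
    then have "real n \<le> c1 * \<rho> n"
      using C pos[OF n] by (simp add: c1_def field_simps add_increasing)
    moreover have "\<rho> n ^ g \<le> (\<Sum>n\<in>{3..<n0}. \<rho> n ^ g)"
      using mem pos by (intro member_le_sum) (auto intro!: less_imp_le)
    then have "\<rho> n ^ g \<le> c2" using C by (simp add: c2_def)
    then have "real n * \<rho> n ^ g \<le> real n * c2" by (intro mult_left_mono) auto
    then have "real n \<le> c2 * real n / \<rho> n ^ g"
      using pos[OF n] by (simp add: field_simps)
    moreover obtain F :: "(real ^ 'd) set set"
      where "finite F" "card F = n" "\<forall>B\<in>F. axis_box B"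
        "real (clique_number F (intersection_edges F)) \<le> real n"
        "real (independence_number F (intersection_edges F)) \<le> real n"
      using axis_boxes_trivial[of n] by blast
    ultimately show ?thesis by (intro exI[of _ F] conjI) (assumption | linarith)+
  qed
  moreover have "c1 \<ge> 0" "c2 \<ge> 0" using C c1 c2 by auto
  ultimately show ?thesis
    unfolding \<rho>_def[symmetric] powi by (intro exI[of _ c1] exI[of _ c2]) simp
qed

end
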